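(* Let $G=(V,E)$ be a nonempty finite simple graph with chromatic polynomial $\chi_G$, and let $m\ge3$ be an integer. Let $\mathcal A_{\mathbb R}(G;m)\subset\mathbb R^V$ be the hyperplane arrangement consisting of the hyperplanes $\{\mathbf z\in\mathbb R^V: z_v=z_w\}$ for all edges $\{v,w\}\in E$ together with the hyperplanes $\{\mathbf z\in\mathbb R^V: z_v=i\}$ for all $v\in V$ and $i\in\{0,1,\ldots,m-2\}$. Then $\mathcal A_{\mathbb R}(G;m)$ has exactly $(-1)^{|V|}\chi_G(-(m-2))$ bounded regions.
   Context: A region of a real hyperplane arrangement in $\mathbb R^V$ is a connected component of the complement in $\mathbb R^V$ of the union of its hyperplanes. $\chi_G$ is the polynomial whose value at each nonnegative integer $x$ is the number of proper vertex colorings of $G$ with $x$ colors. *)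

theory Defs
  imports "HOL-Analysis.Analysis" "HOL-Computational_Algebra.Polynomial"
begin

text \<open>
  A finite simple graph whose vertex set \<open>V\<close> is the (nonempty) universe of a finite type
  is given by its set of edges, so that \<open>\<real>\<^sup>V\<close> is the type \<^typ>\<open>real ^ 'v\<close>.
\<close>

definition simple_graph :: "'v::finite set set \<Rightarrow> bool" where
  "simple_graph E \<longleftrightarrow> (\<forall>e\<in>E. card e = 2)"

definition proper_colorings :: "'v::finite set set \<Rightarrow> nat \<Rightarrow> ('v \<Rightarrow> nat) set" where
  "proper_colorings E x =
    {c. (\<forall>v. c v \<in> {..<x}) \<and> (\<forall>v w. {v, w} \<in> E \<longrightarrow> c v \<noteq> c w)}"

definition chromatic_poly :: "'v::finite set set \<Rightarrow> int poly" where
  "chromatic_poly E =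
    (THE p. \<forall>x::nat. poly p (int x) = int (card (proper_colorings E x)))"

definition graph_arrangement :: "'v::finite set set \<Rightarrow> int \<Rightarrow> (real ^ 'v) set set" where
  "graph_arrangement E m =
    {{z. z $ v = z $ w} | v w. {v, w} \<in> E} \<union>
    {{z. z $ v = of_int i} | v i. i \<in> {0..m - 2}}"

definition regions :: "(real ^ 'v::finite) set set \<Rightarrow> (real ^ 'v) set set" where
  "regions A = components (- \<Union>A)"

definition bounded_regions :: "(real ^ 'v::finite) set set \<Rightarrow> (real ^ 'v) set set" where
  "bounded_regions A = {R \<in> regions A. bounded R}"

end

theory Submission
  imports Defs
begin

text \<open>
  The complement of the arrangement splits into convex cells on which every defining functional
  has constant sign; these are the regions, and a cell is bounded iff it lies in the cube
  \<open>(0, n)\<^sup>V\<close>, where \<open>n = m - 2\<close>. For \<open>W \<subseteq> V\<close> let \<open>R\<^sub>n(W)\<close> be the number of sign patterns of generic points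
  of \<open>(0, n)\<^sup>W\<close>. In a generic point of \<open>(0, n + 1)\<^sup>W\<close> consider the vertices in the top unit interval
  that lie above all their neighbours. They form a stable set, which is empty iff the point lies in
  \<open>(0, n)\<^sup>W\<close>, and a pattern in which it contains \<open>S\<close> is determined by its restriction to \<open>W - S\<close>.
  Inclusion-exclusion gives \<open>\<Sum>\<^sub>S (-1)\<^bsup>|S|\<^esup> R\<^sub>n\<^sub>+\<^sub>1(W - S) = R\<^sub>n(W)\<close>, summed over the stable \<open>S \<subseteq> W\<close>.
  Splitting off the last color class gives \<open>\<chi>\<^sub>W(x + 1) = \<Sum>\<^sub>S \<chi>\<^bsub>W - S\<^esub>(x)\<close>, so that
  \<open>(-1)\<^bsup>|W|\<^esup> \<chi>\<^sub>W(-n)\<close> satisfies the same recursion with the same values at \<open>n = 0\<close>.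
\<close>

section \<open>Colorings of induced subgraphs\<close>

definition stable_set :: "'v::finite set set \<Rightarrow> 'v set \<Rightarrow> bool" where
  "stable_set E S \<longleftrightarrow> (\<forall>v\<in>S. \<forall>w\<in>S. {v, w} \<notin> E)"

text \<open>Extensional functions make a coloring of the subgraph induced on \<open>W\<close> a
  single object, so the sets are finite and can be counted for all \<open>W\<close> at once.\<close>

definition colorings_on :: "'v::finite set set \<Rightarrow> 'v set \<Rightarrow> nat \<Rightarrow> ('v \<Rightarrow> nat) set" where
  "colorings_on E W x =
    {c \<in> W \<rightarrow>\<^sub>E {..<x}. \<forall>v\<in>W. \<forall>w\<in>W. {v, w} \<in> E \<longrightarrow> c v \<noteq> c w}"

section \<open>Polynomiality of the number of colorings\<close>

text \<open>The difference would have infinitely many roots. This makes the description in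
  \<open>chromatic_poly\<close> unique and carries identities from color counts to negative
  arguments.\<close>

lemma int_poly_eqI_nat:
  fixes p q :: "int poly"
  assumes "\<And>x::nat. poly p (int x) = poly q (int x)"
  shows "p = q"
proof (rule ccontr)
  assume "p \<noteq> q"
  then have "finite {x. poly (p - q) x = 0}"
    by (intro poly_roots_finite) simp
  moreover have "range int \<subseteq> {x. poly (p - q) x = 0}"
    using assms by auto
  ultimately show False
    by (meson finite_subset infinite_UNIV_nat finite_imageD inj_of_nat)
qed

text \<open>Functions constant on the classes of \<open>r\<close> correspond to arbitrary functions
  on the quotient.\<close>

lemma card_funcset_respecting:
  assumes "finite W" "equiv W r"
  shows "card {c \<in> W \<rightarrow>\<^sub>E {..<x::nat}. \<forall>(v, w)\<in>r. c v = c w} = x ^ card (W // r)"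
proof -
  have r_iff: "(v, w) \<in> r \<longleftrightarrow> v \<in> W \<and> w \<in> W \<and> r `` {v} = r `` {w}" for v w
    using assms(2) by (metis eq_equiv_class_iff equiv_class_eq_iff)
  have cls: "r `` {v} \<in> W // r" if "v \<in> W" for v
    using that by (rule quotientI)
  define h where "h = (\<lambda>g. \<lambda>v\<in>W. g (r `` {v}) :: nat)"
  have "bij_betw h ((W // r) \<rightarrow>\<^sub>E {..<x}) {c \<in> W \<rightarrow>\<^sub>E {..<x}. \<forall>(v, w)\<in>r. c v = c w}"
  proof (rule bij_betw_imageI)
    show "inj_on h ((W // r) \<rightarrow>\<^sub>E {..<x})"
    proof (rule inj_onI)
      fix f g assume f: "f \<in> (W // r) \<rightarrow>\<^sub>E {..<x}" and g: "g \<in> (W // r) \<rightarrow>\<^sub>E {..<x}"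
        and eq: "h f = h g"
      have "f X = g X" if X: "X \<in> W // r" for X
      proof -
        obtain v where "v \<in> W" "X = r `` {v}"
          by (rule quotientE[OF X])
        then show ?thesis
          using fun_cong[OF eq, of v] by (simp add: h_def)
      qed
      then show "f = g" using PiE_ext f g by blast
    qed
    show "h ` ((W // r) \<rightarrow>\<^sub>E {..<x}) = {c \<in> W \<rightarrow>\<^sub>E {..<x}. \<forall>(v, w)\<in>r. c v = c w}"
    proof (intro equalityI subsetI)
      fix c assume "c \<in> h ` ((W // r) \<rightarrow>\<^sub>E {..<x})"
      then obtain g where g: "g \<in> (W // r) \<rightarrow>\<^sub>E {..<x}" and c: "c = h g" by auto
      have "c \<in> W \<rightarrow>\<^sub>E {..<x}"
        using PiE_mem[OF g] cls by (auto simp: c h_def)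
      moreover have "\<forall>(v, w)\<in>r. c v = c w"
        by (auto simp: c h_def r_iff)
      ultimately show "c \<in> {c \<in> W \<rightarrow>\<^sub>E {..<x}. \<forall>(v, w)\<in>r. c v = c w}" by simp
    next
      fix c assume c: "c \<in> {c \<in> W \<rightarrow>\<^sub>E {..<x}. \<forall>(v, w)\<in>r. c v = c w}"
      define g where "g = (\<lambda>X\<in>W // r. c (SOME v. v \<in> X))"
      have some: "(v, SOME w. w \<in> r `` {v}) \<in> r" if "v \<in> W" for v
      proof -
        have "v \<in> r `` {v}" using assms(2) that by (rule equiv_class_self)
        then have "(SOME w. w \<in> r `` {v}) \<in> r `` {v}" by (rule someI)
        then show ?thesis by simp
      qed
      have gv: "g (r `` {v}) = c v" if "v \<in> W" for v
        using some[OF that] c cls[OF that] by (auto simp: g_def)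
      have "h g = c"
      proof
        have "c \<in> W \<rightarrow>\<^sub>E {..<x}" using c by blast
        from PiE_arb[OF this] show "h g v = c v" for v
          by (cases "v \<in> W") (simp_all add: h_def gv)
      qed
      moreover have "g \<in> (W // r) \<rightarrow>\<^sub>E {..<x}"
      proof (rule PiE_I)
        fix X assume X: "X \<in> W // r"
        obtain v where "v \<in> W" "X = r `` {v}"
          by (rule quotientE[OF X])
        then show "g X \<in> {..<x}" using gv c by (auto dest: PiE_mem)
      qed (simp add: g_def)
      ultimately show "c \<in> h ` ((W // r) \<rightarrow>\<^sub>E {..<x})" by blast
    qed
  qed
  then have "card {c \<in> W \<rightarrow>\<^sub>E {..<x}. \<forall>(v, w)\<in>r. c v = c w} = card ((W // r) \<rightarrow>\<^sub>E {..<x})"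
    by (simp add: bij_betw_same_card)
  also have "\<dots> = x ^ card (W // r)"
    using assms by (simp add: card_PiE finite_quotient equiv_type)
  finally show ?thesis .
qed

text \<open>Deletion-contraction, with a contraction recorded as an equality constraint in
  \<open>F\<close>, so that the vertex set stays \<open>W\<close>. Once \<open>D\<close> is
  exhausted, only functions on a quotient of \<open>W\<close> remain.\<close>

lemma constrained_colorings_poly:
  assumes "finite W" "finite D" "D \<subseteq> W \<times> W" "F \<subseteq> W \<times> W"
  shows "\<exists>p::int poly. \<forall>x::nat. poly p (int x) =
    int (card {c \<in> W \<rightarrow>\<^sub>E {..<x}. (\<forall>(v, w)\<in>F. c v = c w) \<and> (\<forall>(v, w)\<in>D. c v \<noteq> c w)})"
  using assms(2-4)
proof (induction D arbitrary: F rule: finite_induct)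
  case empty
  \<comment> \<open>The equivalence on \<open>W\<close> generated by \<open>F\<close>; the
    intersection removes the reflexive pairs outside \<open>W\<close>.\<close>
  define r where "r = (F \<union> F\<inverse>)\<^sup>* \<inter> W \<times> W"
  have "equiv W r"
  proof (rule equivI)
    show "refl_on W r" by (auto simp: r_def refl_on_def)
    have "sym ((F \<union> F\<inverse>)\<^sup>*)" by (intro sym_rtrancl sym_Un_converse)
    then show "sym r" by (auto simp: r_def sym_def)
    show "trans r" using trans_rtrancl by (auto simp: r_def trans_def)
  qed (auto simp: r_def)
  have "(\<forall>(v, w)\<in>F. c v = c w) \<longleftrightarrow> (\<forall>(v, w)\<in>r. c v = c w)" for c :: "'a \<Rightarrow> nat"
  proof
    assume F: "\<forall>(v, w)\<in>F. c v = c w"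
    have "c v = c w" if "(v, w) \<in> (F \<union> F\<inverse>)\<^sup>*" for v w
      using that by (induction rule: rtrancl_induct) (use F in auto)
    then show "\<forall>(v, w)\<in>r. c v = c w" by (auto simp: r_def)
  next
    assume "\<forall>(v, w)\<in>r. c v = c w"
    moreover have "F \<subseteq> r" using empty by (auto simp: r_def)
    ultimately show "\<forall>(v, w)\<in>F. c v = c w" by blast
  qed
  then show ?case
    using card_funcset_respecting[OF assms(1) \<open>equiv W r\<close>]
    by (intro exI[of _ "monom 1 (card (W // r))"]) (simp add: poly_monom)
next
  case (insert e D)
  obtain v w where e: "e = (v, w)" by (cases e)
  let ?C = "\<lambda>F D x. {c \<in> W \<rightarrow>\<^sub>E {..<x::nat}. (\<forall>(v, w)\<in>F. c v = c w) \<and> (\<forall>(v, w)\<in>D. c v \<noteq> c w)}"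
  obtain p where p: "\<And>x::nat. poly p (int x) = int (card (?C F D x))"
    using insert.IH[of F] insert.prems by auto
  obtain q where q: "\<And>x::nat. poly q (int x) = int (card (?C (insert e F) D x))"
    using insert.IH[of "insert e F"] insert.prems by auto
  have "poly (p - q) (int x) = int (card (?C F (insert e D) x))" for x
  proof -
    have fin: "finite (W \<rightarrow>\<^sub>E {..<x})" using assms(1) by (intro finite_PiE) auto
    \<comment> \<open>Colorings for \<open>F\<close> and \<open>D\<close> are split according to
      whether the ends of \<open>e\<close> get different colors or the same one.\<close>
    have eq: "?C F D x = ?C F (insert e D) x \<union> ?C (insert e F) D x"
      by (auto simp: e)
    have "card (?C F D x) = card (?C F (insert e D) x) + card (?C (insert e F) D x)"
      unfolding eq by (rule card_Un_disjoint) (use fin in \<open>auto simp: e\<close>)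
    then show ?thesis by (simp add: p q)
  qed
  then show ?case by blast
qed

lemma colorings_on_poly:
  fixes E :: "'v::finite set set"
  shows "\<exists>p::int poly. \<forall>x::nat. poly p (int x) = int (card (colorings_on E W x))"
proof -
  have "colorings_on E W x =
     {c \<in> W \<rightarrow>\<^sub>E {..<x}. (\<forall>(v, w)\<in>{}. c v = c w) \<and>
       (\<forall>(v, w)\<in>{(v, w). v \<in> W \<and> w \<in> W \<and> {v, w} \<in> E}. c v \<noteq> c w)}" for x
    by (auto simp: colorings_on_def)
  then show ?thesis
    using constrained_colorings_poly[of W "{(v, w). v \<in> W \<and> w \<in> W \<and> {v, w} \<in> E}" "{}"]
    by auto
qed

lemma finite_colorings_on: "finite (colorings_on E W x)"
proof -
  have "finite (W \<rightarrow>\<^sub>E {..<x})" by (intro finite_PiE) auto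
  then show ?thesis by (simp add: colorings_on_def)
qed

lemma colorings_on_0: "card (colorings_on E W 0) = (if W = {} then 1 else 0)"
  by (auto simp: colorings_on_def PiE_eq_empty_iff)

section \<open>Splitting off the last color class\<close>

text \<open>Erasing the class \<open>S\<close> of the last color \<open>x\<close> is undone by
  giving all of \<open>S\<close> that color, which is proper because \<open>S\<close> is stable and
  \<open>x\<close> is new on \<open>W - S\<close>.\<close>

lemma card_colorings_on_top_class:
  assumes "S \<subseteq> W" "stable_set E S"
  shows "card {c \<in> colorings_on E W (Suc x). {v \<in> W. c v = x} = S} = card (colorings_on E (W - S) x)"
proof -
  let ?A = "{c \<in> colorings_on E W (Suc x). {v \<in> W. c v = x} = S}"
  let ?ext = "\<lambda>c v. if v \<in> S then x else c v"
  have 1: "restrict c (W - S) \<in> colorings_on E (W - S) x \<and> ?ext (restrict c (W - S)) = c"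
    if "c \<in> ?A" for c
  proof -
    have c: "c \<in> W \<rightarrow>\<^sub>E {..<Suc x}" "\<And>v. v \<in> W \<Longrightarrow> c v = x \<longleftrightarrow> v \<in> S"
      "\<And>v w. v \<in> W \<Longrightarrow> w \<in> W \<Longrightarrow> {v, w} \<in> E \<Longrightarrow> c v \<noteq> c w"
      using that by (auto simp: colorings_on_def)
    have "c v < x" if "v \<in> W - S" for v
      using c(2)[of v] PiE_mem[OF c(1), of v] that by auto
    then have "restrict c (W - S) \<in> colorings_on E (W - S) x"
      using c(3) by (simp add: colorings_on_def restrict_PiE_iff)
    moreover have "?ext (restrict c (W - S)) = c"
    proof
      fix v
      show "?ext (restrict c (W - S)) v = c v"
        using c(2)[of v] PiE_arb[OF c(1), of v] assms(1) by auto
    qed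
    ultimately show ?thesis by (rule conjI)
  qed
  have 2: "?ext c \<in> ?A \<and> restrict (?ext c) (W - S) = c" if "c \<in> colorings_on E (W - S) x" for c
  proof -
    have c: "c \<in> (W - S) \<rightarrow>\<^sub>E {..<x}"
      "\<And>v w. v \<in> W - S \<Longrightarrow> w \<in> W - S \<Longrightarrow> {v, w} \<in> E \<Longrightarrow> c v \<noteq> c w"
      using that by (auto simp: colorings_on_def)
    have lt: "c v < x" if "v \<in> W" "v \<notin> S" for v
      using PiE_mem[OF c(1), of v] that by auto
    have funcset: "?ext c \<in> W \<rightarrow>\<^sub>E {..<Suc x}"
      using lt assms(1) PiE_arb[OF c(1)] by (intro PiE_I) (auto simp: less_Suc_eq)
    have proper: "?ext c v \<noteq> ?ext c w" if "v \<in> W" "w \<in> W" "{v, w} \<in> E" for v w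
      using that assms(2) c(2)[of v w] lt[of v] lt[of w] by (auto simp: stable_set_def)
    have top: "{v \<in> W. ?ext c v = x} = S"
    proof (intro equalityI subsetI)
      fix v assume "v \<in> {v \<in> W. ?ext c v = x}"
      then show "v \<in> S" using lt[of v] by (auto split: if_splits)
    qed (use assms(1) in auto)
    have "restrict (?ext c) (W - S) = c"
    proof
      show "restrict (?ext c) (W - S) v = c v" for v
        using PiE_arb[OF c(1), of v] by (auto simp: restrict_def)
    qed
    moreover have "?ext c \<in> ?A"
      unfolding colorings_on_def using funcset proper top by blast
    ultimately show ?thesis by blast
  qed
  have "bij_betw (\<lambda>c. restrict c (W - S)) ?A (colorings_on E (W - S) x)"
    by (rule bij_betw_byWitness[where f' = ?ext];
        intro ballI image_subsetI conjunct1[OF 1] conjunct2[OF 1] conjunct1[OF 2] conjunct2[OF 2])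
  then show ?thesis by (rule bij_betw_same_card)
qed

lemma card_colorings_on_Suc:
  "card (colorings_on E W (Suc x)) = (\<Sum>S | S \<subseteq> W \<and> stable_set E S. card (colorings_on E (W - S) x))"
proof -
  let ?top = "\<lambda>c. {v \<in> W. c v = x}"
  have "?top ` colorings_on E W (Suc x) \<subseteq> {S. S \<subseteq> W \<and> stable_set E S}"
    by (fastforce simp: colorings_on_def stable_set_def)
  then have "card (colorings_on E W (Suc x)) =
    (\<Sum>S | S \<subseteq> W \<and> stable_set E S. \<Sum>c | c \<in> colorings_on E W (Suc x) \<and> ?top c = S. 1)"
    by (subst sum.group) (auto simp: finite_colorings_on)
  also have "\<dots> = (\<Sum>S | S \<subseteq> W \<and> stable_set E S. card (colorings_on E (W - S) x))"
    using card_colorings_on_top_class by (intro sum.cong) auto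
  finally show ?thesis .
qed

section \<open>Sign patterns of points in the box\<close>

text \<open>Points are functions on all vertices with conditions only on \<open>W\<close>, so one
  point serves for \<open>W\<close> and for all its subsets.\<close>

definition generic_points :: "'v::finite set set \<Rightarrow> 'v set \<Rightarrow> nat \<Rightarrow> ('v \<Rightarrow> real) set" where
  "generic_points E W n =
    {z. (\<forall>v\<in>W. 0 < z v \<and> z v < real n \<and> z v \<notin> \<int>) \<and>
        (\<forall>v\<in>W. \<forall>w\<in>W. {v, w} \<in> E \<longrightarrow> z v \<noteq> z w)}"

text \<open>Inside the box this is the sign vector of the arrangement: the relation tells the side
  of each edge hyperplane, the floors tell the side of each hyperplane at an integer.\<close>

definition pattern ::
    "'v::finite set set \<Rightarrow> 'v set \<Rightarrow> ('v \<Rightarrow> real) \<Rightarrow> ('v \<times> 'v) set \<times> ('v \<Rightarrow> int)" where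
  "pattern E W z = ({(v, w). v \<in> W \<and> w \<in> W \<and> {v, w} \<in> E \<and> z v < z w}, \<lambda>v\<in>W. \<lfloor>z v\<rfloor>)"

definition patterns ::
    "'v::finite set set \<Rightarrow> 'v set \<Rightarrow> nat \<Rightarrow> (('v \<times> 'v) set \<times> ('v \<Rightarrow> int)) set" where
  "patterns E W n = pattern E W ` generic_points E W n"

text \<open>Read off from the pattern instead of a point, so that inclusion-exclusion can run over
  patterns. An isolated vertex in the top interval counts as well.\<close>

definition top_vertices ::
    "'v::finite set \<Rightarrow> nat \<Rightarrow> ('v \<times> 'v) set \<times> ('v \<Rightarrow> int) \<Rightarrow> 'v set" where
  "top_vertices W n q = {v \<in> W. snd q v = int n \<and> (\<forall>w. (v, w) \<notin> fst q)}"

lemma pattern_eq_iff: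
  "pattern E W z = pattern E W z' \<longleftrightarrow>
    (\<forall>v\<in>W. \<lfloor>z v\<rfloor> = \<lfloor>z' v\<rfloor>) \<and> (\<forall>v\<in>W. \<forall>w\<in>W. {v, w} \<in> E \<longrightarrow> (z v < z w \<longleftrightarrow> z' v < z' w))"
  by (auto simp: pattern_def set_eq_iff fun_eq_iff restrict_def)

lemma top_vertices_pattern:
  "top_vertices W n (pattern E W z) =
    {v \<in> W. \<lfloor>z v\<rfloor> = int n \<and> (\<forall>w\<in>W. {v, w} \<in> E \<longrightarrow> z w \<le> z v)}"
  by (auto simp: top_vertices_def pattern_def not_less)

lemma finite_patterns:
  fixes E :: "'v::finite set set"
  shows "finite (patterns E W n)"
proof (rule finite_subset)
  show "patterns E W n \<subseteq> UNIV \<times> (W \<rightarrow>\<^sub>E {0..int n})"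
  proof
    fix q assume "q \<in> patterns E W n"
    then obtain z where z: "z \<in> generic_points E W n" "q = pattern E W z"
      by (auto simp: patterns_def)
    have "0 \<le> \<lfloor>z v\<rfloor> \<and> \<lfloor>z v\<rfloor> \<le> int n" if "v \<in> W" for v
    proof -
      have "0 < z v" "z v < real n" using z(1) that by (auto simp: generic_points_def)
      then show ?thesis by (simp add: floor_le_iff)
    qed
    then show "q \<in> UNIV \<times> (W \<rightarrow>\<^sub>E {0..int n})"
      by (simp add: z(2) pattern_def restrict_PiE_iff)
  qed
  show "finite ((UNIV :: ('v \<times> 'v) set set) \<times> (W \<rightarrow>\<^sub>E {0..int n}))"
    by (intro finite_cartesian_product finite_PiE) auto
qed

text \<open>Serves to compare patterns on \<open>W\<close> with patterns on \<open>W - S\<close>,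
  and regions with patterns, through common representing points.\<close>

lemma card_image_same_kernel:
  assumes "\<And>x y. x \<in> A \<Longrightarrow> y \<in> A \<Longrightarrow> f x = f y \<longleftrightarrow> g x = g y"
  shows "card (f ` A) = card (g ` A)" and "finite (f ` A) \<longleftrightarrow> finite (g ` A)"
proof -
  define h where "h = (\<lambda>y. g (SOME x. x \<in> A \<and> f x = y))"
  have hf: "h (f x) = g x" if "x \<in> A" for x
  proof -
    have "(SOME x'. x' \<in> A \<and> f x' = f x) \<in> A \<and> f (SOME x'. x' \<in> A \<and> f x' = f x) = f x"
      by (rule someI[of _ x]) (use that in simp)
    then show ?thesis using assms that unfolding h_def by blast
  qed
  have "bij_betw h (f ` A) (g ` A)"
    unfolding bij_betw_def using assms hf by (auto intro!: inj_onI simp: image_image)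
  then show "card (f ` A) = card (g ` A)" and "finite (f ` A) \<longleftrightarrow> finite (g ` A)"
    by (simp_all add: bij_betw_same_card bij_betw_finite)
qed

section \<open>Inclusion-exclusion over the top vertices\<close>

lemma generic_points_mono:
  assumes "z \<in> generic_points E W n" "W' \<subseteq> W"
  shows "z \<in> generic_points E W' n"
  using assms by (auto simp: generic_points_def)

text \<open>All of \<open>S\<close> can be put at one height \<open>t\<close> above every other
  coordinate; equal values within \<open>S\<close> are harmless because \<open>S\<close> is
  stable.\<close>

lemma extend_to_top:
  assumes "S \<subseteq> W" "stable_set E S" and z: "z \<in> generic_points E (W - S) (Suc n)"
  obtains z' where "z' \<in> generic_points E W (Suc n)" "S \<subseteq> top_vertices W n (pattern E W z')"
    "pattern E (W - S) z' = pattern E (W - S) z"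
proof -
  \<comment> \<open>Inserting \<open>real n\<close> forces \<open>t\<close> into the top unit
    interval and keeps the maximum defined when \<open>W = S\<close>.\<close>
  define M where "M = Max (insert (real n) (z ` (W - S)))"
  have "M < real (Suc n)" "real n \<le> M"
    using z by (auto simp: M_def generic_points_def)
  have M: "z v \<le> M" if "v \<in> W" "v \<notin> S" for v
    unfolding M_def using that by (intro Max_ge) auto
  obtain t where t: "M < t" "t < real (Suc n)" using \<open>M < real (Suc n)\<close> dense by blast
  have fl: "\<lfloor>t\<rfloor> = int n" using t \<open>real n \<le> M\<close> by (simp add: floor_eq_iff)
  have tZ: "t \<notin> \<int>"
  proof
    assume "t \<in> \<int>"
    then have "t = real n" using fl by (auto elim!: Ints_cases)
    then show False using t \<open>real n \<le> M\<close> by simp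
  qed
  define z' where "z' = (\<lambda>v. if v \<in> S then t else z v)"
  show ?thesis
  proof (rule that)
    have ne: "z' v \<noteq> z' w" if "v \<in> W" "w \<in> W" "{v, w} \<in> E" for v w
      using that assms(2) M[of v] M[of w] t z
      by (auto simp: z'_def stable_set_def generic_points_def)
    have "0 < z' v \<and> z' v < real (Suc n) \<and> z' v \<notin> \<int>" if "v \<in> W" for v
      using that z t tZ \<open>real n \<le> M\<close> by (auto simp: z'_def generic_points_def)
    then show "z' \<in> generic_points E W (Suc n)" using ne by (simp add: generic_points_def)
    show "S \<subseteq> top_vertices W n (pattern E W z')"
      using assms(1) M t fl by (fastforce simp: top_vertices_pattern z'_def)
    show "pattern E (W - S) z' = pattern E (W - S) z"
      by (auto simp: pattern_eq_iff z'_def)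
  qed
qed

text \<open>Forgetting the coordinates in \<open>S\<close> is injective on these patterns, whose
  data at \<open>S\<close> are forced, and surjective by \<open>extend_to_top\<close>.\<close>

lemma card_patterns_top_superset:
  assumes "S \<subseteq> W" "stable_set E S"
  shows "card {q \<in> patterns E W (Suc n). S \<subseteq> top_vertices W n q} = card (patterns E (W - S) (Suc n))"
proof -
  let ?A = "{z \<in> generic_points E W (Suc n). S \<subseteq> top_vertices W n (pattern E W z)}"
  \<comment> \<open>Every comparison along an edge meeting \<open>S\<close> is forced; no edge has both ends in \<open>S\<close>.\<close>
  have lt: "z v < z w \<longleftrightarrow> v \<notin> S"
    if "z \<in> ?A" "v \<in> W" "w \<in> W" "{v, w} \<in> E" "v \<in> S \<or> w \<in> S" for z v w
  proof -
    have "z v \<noteq> z w" using that by (auto simp: generic_points_def)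
    moreover have "z w \<le> z v" if "v \<in> S"
      using \<open>z \<in> ?A\<close> that \<open>w \<in> W\<close> \<open>{v, w} \<in> E\<close> by (auto simp: top_vertices_pattern)
    moreover have "z v \<le> z w" if "w \<in> S"
    proof -
      have "{w, v} \<in> E" using \<open>{v, w} \<in> E\<close> by (simp add: insert_commute)
      then show ?thesis using \<open>z \<in> ?A\<close> that \<open>v \<in> W\<close> by (auto simp: top_vertices_pattern)
    qed
    ultimately show ?thesis using that(5) by fastforce
  qed
  have fl: "\<lfloor>z v\<rfloor> = int n" if "z \<in> ?A" "v \<in> S" for z v
    using that by (auto simp: top_vertices_pattern)
  have "{q \<in> patterns E W (Suc n). S \<subseteq> top_vertices W n q} = pattern E W ` ?A"
    by (auto simp: patterns_def)
  moreover have "card (pattern E W ` ?A) = card (pattern E (W - S) ` ?A)"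
  proof (rule card_image_same_kernel(1))
    fix z z' assume z: "z \<in> ?A" and z': "z' \<in> ?A"
    show "pattern E W z = pattern E W z' \<longleftrightarrow> pattern E (W - S) z = pattern E (W - S) z'"
    proof
      assume eq: "pattern E (W - S) z = pattern E (W - S) z'"
      have "\<lfloor>z v\<rfloor> = \<lfloor>z' v\<rfloor>" if "v \<in> W" for v
        using eq fl[OF z] fl[OF z'] that unfolding pattern_eq_iff by (cases "v \<in> S") auto
      moreover have "z v < z w \<longleftrightarrow> z' v < z' w" if "v \<in> W" "w \<in> W" "{v, w} \<in> E" for v w
        using eq lt[OF z that] lt[OF z' that] that unfolding pattern_eq_iff
        by (cases "v \<in> S \<or> w \<in> S") auto
      ultimately show "pattern E W z = pattern E W z'" by (simp add: pattern_eq_iff)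
    qed (auto simp: pattern_eq_iff)
  qed
  moreover have "pattern E (W - S) ` ?A = patterns E (W - S) (Suc n)"
  proof
    show "pattern E (W - S) ` ?A \<subseteq> patterns E (W - S) (Suc n)"
      using generic_points_mono[of _ E W "Suc n" "W - S"] by (auto simp: patterns_def)
    show "patterns E (W - S) (Suc n) \<subseteq> pattern E (W - S) ` ?A"
    proof
      fix q assume "q \<in> patterns E (W - S) (Suc n)"
      then obtain z where "z \<in> generic_points E (W - S) (Suc n)" "q = pattern E (W - S) z"
        by (auto simp: patterns_def)
      then show "q \<in> pattern E (W - S) ` ?A"
        by (elim extend_to_top[OF assms]) (auto intro!: rev_image_eqI)
    qed
  qed
  ultimately show ?thesis by simp
qed

text \<open>If some coordinate lies above \<open>n\<close>, then a vertex of globally largest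
  coordinate is a top vertex.\<close>

lemma patterns_top_empty:
  "{q \<in> patterns E W (Suc n). top_vertices W n q = {}} = patterns E W n"
proof -
  have "z \<in> generic_points E W (Suc n) \<and> top_vertices W n (pattern E W z) = {} \<longleftrightarrow>
        z \<in> generic_points E W n" for z
  proof
    assume z: "z \<in> generic_points E W n"
    then have "\<lfloor>z v\<rfloor> \<noteq> int n" if "v \<in> W" for v
    proof -
      have "z v < real n" using z that by (simp add: generic_points_def)
      then show ?thesis by (simp add: floor_eq_iff)
    qed
    moreover have "z v < real (Suc n)" if "v \<in> W" for v
    proof -
      have "z v < real n" using z that by (simp add: generic_points_def)
      then show ?thesis by simp
    qed
    then have "z \<in> generic_points E W (Suc n)"
      using z by (simp add: generic_points_def)
    ultimately show "z \<in> generic_points E W (Suc n) \<and> top_vertices W n (pattern E W z) = {}"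
      by (auto simp: top_vertices_pattern)
  next
    assume z: "z \<in> generic_points E W (Suc n) \<and> top_vertices W n (pattern E W z) = {}"
    have "z v < real n" if v: "v \<in> W" for v
    proof (rule ccontr)
      assume "\<not> z v < real n"
      define M where "M = Max (z ` W)"
      have "M \<in> z ` W"
        unfolding M_def by (rule Max_in) (use v in auto)
      then obtain u where u: "u \<in> W" "z u = M" by blast
      have M: "z w \<le> z u" if "w \<in> W" for w
        using that by (simp add: u M_def)
      have "\<lfloor>z u\<rfloor> = int n"
        using M[OF v] \<open>\<not> z v < real n\<close> conjunct1[OF z] u(1)
        by (simp add: generic_points_def floor_eq_iff add.commute)
      then have "u \<in> top_vertices W n (pattern E W z)"
        using u(1) M by (simp add: top_vertices_pattern)
      then show False using z by simp
    qed
    then show "z \<in> generic_points E W n" using z by (simp add: generic_points_def)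
  qed
  then have "generic_points E W n =
      {z \<in> generic_points E W (Suc n). top_vertices W n (pattern E W z) = {}}"
    by simp
  then show ?thesis
    by (intro set_eqI) (simp only: patterns_def image_iff mem_Collect_eq Bex_def, metis)
qed

text \<open>Of two adjacent top vertices each would lie weakly above the other, and equality
  contradicts genericity.\<close>

lemma stable_set_top_vertices:
  assumes "q \<in> patterns E W n"
  shows "stable_set E (top_vertices W k q)"
  unfolding stable_set_def
proof (intro ballI notI)
  obtain z where z: "z \<in> generic_points E W n" "q = pattern E W z"
    using assms by (auto simp: patterns_def)
  fix v w assume "v \<in> top_vertices W k q" "w \<in> top_vertices W k q" "{v, w} \<in> E"
  moreover from \<open>{v, w} \<in> E\<close> have "{w, v} \<in> E" by (simp add: insert_commute)
  ultimately have "z v = z w" "v \<in> W" "w \<in> W"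
    by (auto simp: z(2) top_vertices_pattern intro: antisym)
  then show False using z(1) \<open>{v, w} \<in> E\<close> by (auto simp: generic_points_def)
qed

lemma sum_Pow_alternating:
  assumes "finite A"
  shows "(\<Sum>X\<in>Pow A. (-1::int) ^ card X) = (if A = {} then 1 else 0)"
  \<comment> \<open>Expansion of the product of the factors \<open>1 - 1\<close> over
    \<open>A\<close>.\<close>
  using prod_diff_conv_sum[of A "\<lambda>_. 1::int" "\<lambda>_. 1"] assms by (simp add: power_0_left)

text \<open>After exchanging the sums, a pattern contributes the alternating sum over all subsets of
  its top vertices, each of which is stable. Only patterns without top vertices survive.\<close>

lemma alternating_sum_patterns:
  "(\<Sum>S | S \<subseteq> W \<and> stable_set E S. (-1) ^ card S * int (card (patterns E (W - S) (Suc n)))) =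
    int (card (patterns E W n))"
proof -
  let ?P = "patterns E W (Suc n)" and ?T = "top_vertices W n"
  let ?St = "{S. S \<subseteq> W \<and> stable_set E S}"
  have sub: "{S \<in> ?St. S \<subseteq> ?T q} = Pow (?T q)" if "q \<in> ?P" for q
    using stable_set_top_vertices[OF that, of n] by (auto simp: stable_set_def top_vertices_def)
  have "(\<Sum>S\<in>?St. (-1) ^ card S * int (card (patterns E (W - S) (Suc n)))) =
        (\<Sum>S\<in>?St. \<Sum>q | q \<in> ?P \<and> S \<subseteq> ?T q. (-1) ^ card S)"
    using card_patterns_top_superset[of _ W E n]
    by (intro sum.cong) (auto simp: mult.commute)
  also have "\<dots> = (\<Sum>q\<in>?P. \<Sum>S | S \<in> ?St \<and> S \<subseteq> ?T q. (-1) ^ card S)"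
    by (rule sum.swap_restrict) (auto simp: finite_patterns)
  also have "\<dots> = (\<Sum>q\<in>?P. if ?T q = {} then 1 else 0)"
    by (intro sum.cong refl) (simp only: sub sum_Pow_alternating finite)
  also have "\<dots> = int (card {q \<in> ?P. ?T q = {}})"
    by (simp add: finite_patterns sum.If_cases Int_def)
  finally show ?thesis by (simp add: patterns_top_empty)
qed

lemma card_patterns_0: "card (patterns E W 0) = (if W = {} then 1 else 0)"
proof (cases "W = {}")
  case True
  then have "generic_points E W 0 = UNIV" "pattern E W = (\<lambda>z. ({}, \<lambda>v. undefined))"
    by (simp_all add: generic_points_def pattern_def fun_eq_iff)
  then show ?thesis using True by (simp add: patterns_def image_constant_conv)
next
  case False
  then obtain v where "v \<in> W" by blast
  then have "z \<notin> generic_points E W 0" for z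
    using less_asym[of 0 "z v"] unfolding generic_points_def by fastforce
  then have "generic_points E W 0 = {}" by blast
  then show ?thesis using False by (simp add: patterns_def)
qed

section \<open>Comparison of the two recursions\<close>

text \<open>The term \<open>S = {}\<close> of the alternating sum is the count for \<open>W\<close>
  and \<open>Suc n\<close>. The other terms concern proper subsets of \<open>W\<close>, whence an
  induction on \<open>W\<close> inside the one on \<open>n\<close>.\<close>

lemma card_patterns_eq_poly:
  fixes E :: "'v::finite set set" and p :: "'v set \<Rightarrow> int poly"
  assumes p: "\<And>W x. poly (p W) (int x) = int (card (colorings_on E W x))"
  shows "int (card (patterns E W n)) = (-1) ^ card W * poly (p W) (- int n)"
proof (induction n arbitrary: W)
  case 0
  then show ?case using p[of W 0] by (simp add: card_patterns_0 colorings_on_0)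
next
  case (Suc n)
  note outer = Suc.IH
  let ?St = "\<lambda>W. {S. S \<subseteq> W \<and> stable_set E S}"
  \<comment> \<open>The coloring recursion holds at all naturals, hence as an identity of
    polynomials, hence also at negative \<open>y\<close>.\<close>
  have rec: "poly (p W) (y + 1) = (\<Sum>S\<in>?St W. poly (p (W - S)) y)" for W y
  proof -
    have "pcompose (p W) [:1, 1:] = (\<Sum>S\<in>?St W. p (W - S))"
    proof (rule int_poly_eqI_nat)
      fix x :: nat
      show "poly (pcompose (p W) [:1, 1:]) (int x) = poly (\<Sum>S\<in>?St W. p (W - S)) (int x)"
        using p[of W "Suc x"] by (simp add: poly_pcompose poly_sum p card_colorings_on_Suc)
    qed
    then have "poly (pcompose (p W) [:1, 1:]) y = poly (\<Sum>S\<in>?St W. p (W - S)) y" by simp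
    then show ?thesis by (simp add: poly_pcompose poly_sum add.commute)
  qed
  have "finite W" by simp
  then show ?case
  proof (induction W rule: finite_psubset_induct)
    case (psubset W)
    let ?R = "?St W - {{}}"
    \<comment> \<open>Here \<open>?y + 1\<close> is \<open>- int n\<close>, the argument handled by
      the outer hypothesis.\<close>
    let ?y = "- int (Suc n)"
    have split: "(\<Sum>S\<in>?St W. f S) = f {} + (\<Sum>S\<in>?R. f S)" for f :: "'v set \<Rightarrow> int"
      by (intro sum.remove) (auto simp: stable_set_def)
    have "(-1) ^ card S * int (card (patterns E (W - S) (Suc n))) =
          (-1) ^ card W * poly (p (W - S)) ?y" if "S \<in> ?R" for S
    proof -
      have S: "S \<subseteq> W" "W - S \<subset> W" using that by auto
      have "card W = card S + card (W - S)"
        using S(1) by (simp add: card_Diff_subset card_mono)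
      then show ?thesis using psubset.IH[OF S(2)] by (simp add: power_add)
    qed
    then have R: "(\<Sum>S\<in>?R. (-1) ^ card S * int (card (patterns E (W - S) (Suc n)))) =
        (\<Sum>S\<in>?R. (-1) ^ card W * poly (p (W - S)) ?y)"
      by (rule sum.cong[OF refl])
    have "int (card (patterns E W n)) = int (card (patterns E W (Suc n))) +
        (\<Sum>S\<in>?R. (-1) ^ card W * poly (p (W - S)) ?y)"
      using alternating_sum_patterns[of E W n] unfolding split R by simp
    moreover have "poly (p W) (- int n) = poly (p W) ?y + (\<Sum>S\<in>?R. poly (p (W - S)) ?y)"
      using rec[of W ?y] unfolding split by simp
    ultimately show ?case
      using outer[of W] by (simp add: sum_distrib_left[symmetric] distrib_left)
  qed
qed

section \<open>Components of the complement of an arrangement\<close>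

text \<open>A connected set avoiding a hyperplane stays on one side of it. Conversely, the points
  with the signs of \<open>x\<close> form an intersection of half-spaces, which is convex.\<close>

lemma connected_component_hyperplane_complement:
  fixes H :: "('a::real_inner \<times> real) set"
  defines "U \<equiv> {z. \<forall>(a, b)\<in>H. a \<bullet> z \<noteq> b}"
  assumes "x \<in> U"
  shows "connected_component_set U x = {z \<in> U. \<forall>(a, b)\<in>H. a \<bullet> z < b \<longleftrightarrow> a \<bullet> x < b}"
    (is "_ = ?cell")
proof
  show "connected_component_set U x \<subseteq> ?cell"
  proof
    fix y assume y: "y \<in> connected_component_set U x"
    then obtain T where T: "connected T" "T \<subseteq> U" "x \<in> T" "y \<in> T"
      by (auto simp: connected_component_def)
    have "a \<bullet> y < b \<longleftrightarrow> a \<bullet> x < b" if "(a, b) \<in> H" for a b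
    proof -
      have "a \<bullet> z \<noteq> b" if "z \<in> T" for z using that T \<open>(a, b) \<in> H\<close> by (auto simp: U_def)
      then show ?thesis
        using connected_ivt_hyperplane[OF T(1) T(3) T(4), of a b]
          connected_ivt_hyperplane[OF T(1) T(4) T(3), of a b]
        by (meson linorder_not_less order_less_imp_le)
    qed
    then show "y \<in> ?cell" using T by auto
  qed
  have "?cell = (\<Inter>(a, b)\<in>H. if a \<bullet> x < b then {z. a \<bullet> z < b} else {z. a \<bullet> z > b})"
    using assms(2) by (fastforce simp: U_def split: if_splits)
  moreover have "convex \<dots>"
    by (intro convex_INT) (auto simp: convex_halfspace_lt convex_halfspace_gt)
  ultimately have "connected ?cell" by (simp add: convex_connected)
  then show "?cell \<subseteq> connected_component_set U x"
    using assms(2) by (intro connected_component_maximal) auto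
qed

section \<open>Regions of the graph arrangement and their boundedness\<close>

text \<open>
  The points of \<open>cell E n z\<close> lie off all hyperplanes even if \<open>z\<close> does not, so that
  \<open>z \<in> cell E n z\<close> expresses that \<open>z\<close> belongs to the complement.
\<close>

definition cell :: "'v::finite set set \<Rightarrow> nat \<Rightarrow> real ^ 'v \<Rightarrow> (real ^ 'v) set" where
  "cell E n z = {z'.
    (\<forall>v w. {v, w} \<in> E \<longrightarrow> z' $ v \<noteq> z' $ w \<and> (z' $ v < z' $ w \<longleftrightarrow> z $ v < z $ w)) \<and>
    (\<forall>v. \<forall>i\<in>{0..int n}. z' $ v \<noteq> of_int i \<and> (z' $ v < of_int i \<longleftrightarrow> z $ v < of_int i))}"

lemma complement_graph_arrangement:
  "- \<Union>(graph_arrangement E m) =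
    {z. (\<forall>v w. {v, w} \<in> E \<longrightarrow> z $ v \<noteq> z $ w) \<and> (\<forall>v. \<forall>i\<in>{0..m - 2}. z $ v \<noteq> of_int i)}"
  unfolding graph_arrangement_def by blast

lemma component_graph_arrangement:
  fixes E :: "'v::finite set set"
  assumes "m - 2 = int n" "z \<in> - \<Union>(graph_arrangement E m)"
  shows "connected_component_set (- \<Union>(graph_arrangement E m)) z = cell E n z"
proof -
  \<comment> \<open>Normal vectors with offsets; each edge occurs in both orientations.\<close>
  define H :: "((real ^ 'v) \<times> real) set" where
    "H = {(axis v 1 - axis w 1, 0) | v w. {v, w} \<in> E} \<union>
         {(axis v 1, of_int i) | v i. i \<in> {0..int n}}"
  have H: "(\<forall>(a, b)\<in>H. Q a b) \<longleftrightarrow>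
    (\<forall>v w. {v, w} \<in> E \<longrightarrow> Q (axis v 1 - axis w 1) 0) \<and>
    (\<forall>v. \<forall>i\<in>{0..int n}. Q (axis v 1) (of_int i))" for Q
    unfolding H_def by blast
  note H_simps = H inner_diff_left inner_axis'
  have U: "- \<Union>(graph_arrangement E m) = {z. \<forall>(a, b)\<in>H. a \<bullet> z \<noteq> b}"
    unfolding complement_graph_arrangement H_simps by (simp add: assms(1))
  have "connected_component_set (- \<Union>(graph_arrangement E m)) z =
      {z' \<in> - \<Union>(graph_arrangement E m). \<forall>(a, b)\<in>H. a \<bullet> z' < b \<longleftrightarrow> a \<bullet> z < b}"
    unfolding U by (rule connected_component_hyperplane_complement) (use assms(2) U in simp)
  also have "\<dots> = cell E n z"
    unfolding H_simps complement_graph_arrangement cell_def assms(1) by auto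
  finally show ?thesis .
qed

text \<open>If a coordinate is negative, all negative coordinates can be lowered by a common amount
  without changing any sign; coordinates above \<open>n\<close> can be raised likewise. Otherwise
  the cell lies in a cube.\<close>

lemma bounded_cell_iff:
  assumes "z \<in> cell E n z"
  shows "bounded (cell E n z) \<longleftrightarrow> (\<forall>v. 0 < z $ v \<and> z $ v < real n)"
proof
  assume "bounded (cell E n z)"
  then obtain B where B: "\<And>z'. z' \<in> cell E n z \<Longrightarrow> norm z' \<le> B"
    by (auto simp: bounded_iff)
  have gen: "\<And>v i. 0 \<le> i \<Longrightarrow> i \<le> int n \<Longrightarrow> z $ v \<noteq> of_int i"
    and edge: "\<And>v w. {v, w} \<in> E \<Longrightarrow> z $ v \<noteq> z $ w"
    using assms by (auto simp: cell_def)
  show "\<forall>v. 0 < z $ v \<and> z $ v < real n"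
  proof (rule allI, rule ccontr)
    fix v assume "\<not> (0 < z $ v \<and> z $ v < real n)"
    then consider "z $ v < 0" | "z $ v > real n"
      using gen[of 0 v] gen[of "int n" v] by fastforce
    then show False
    proof cases
      case 1
      \<comment> \<open>Since \<open>z $ v\<close> is negative, the shift by
        \<open>\<bar>B\<bar>\<close> makes the absolute value of this coordinate exceed
        \<open>B\<close>.\<close>
      define z' where "z' = (\<chi> w. if z $ w < 0 then z $ w - \<bar>B\<bar> else z $ w)"
      have "z' \<in> cell E n z"
        using gen edge by (fastforce simp: cell_def z'_def)
      then have "\<bar>z' $ v\<bar> \<le> B" using B component_le_norm_cart order_trans by blast
      then show False using 1 by (simp add: z'_def)
    next
      case 2
      define z' where "z' = (\<chi> w. if z $ w > real n then z $ w + \<bar>B\<bar> else z $ w)"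
      have "z' \<in> cell E n z"
        using gen edge by (fastforce simp: cell_def z'_def)
      then have "\<bar>z' $ v\<bar> \<le> B" using B component_le_norm_cart order_trans by blast
      then show False using 2 by (simp add: z'_def)
    qed
  qed
next
  assume z: "\<forall>v. 0 < z $ v \<and> z $ v < real n"
  have "cell E n z \<subseteq> cbox 0 (vec (real n))"
  proof
    fix z' assume z': "z' \<in> cell E n z"
    have "0 \<le> z' $ v \<and> z' $ v \<le> real n" for v
    proof -
      have "z' $ v < of_int 0 \<longleftrightarrow> z $ v < of_int 0"
        "z' $ v < of_int (int n) \<longleftrightarrow> z $ v < of_int (int n)"
        using z' by (auto simp: cell_def simp del: of_int_0 of_int_of_nat_eq)
      then show ?thesis using z[rule_format, of v] by simp
    qed
    then show "z' \<in> cbox 0 (vec (real n))" by (simp add: mem_box_cart)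
  qed
  then show "bounded (cell E n z)" using bounded_cbox bounded_subset by blast
qed

section \<open>Bounded regions as sign patterns\<close>

lemma cell_eq_iff:
  assumes "z \<in> cell E n z" "z' \<in> cell E n z'"
  shows "cell E n z = cell E n z' \<longleftrightarrow> z' \<in> cell E n z"
proof
  assume "z' \<in> cell E n z"
  then show "cell E n z = cell E n z'"
    \<comment> \<open>Membership makes all signs of \<open>z\<close> and \<open>z'\<close> agree, so
      both cells are cut out by equivalent conditions.\<close>
    unfolding cell_def by (intro Collect_cong) auto
qed (use assms in auto)

lemma cell_eq_iff_pattern_eq:
  assumes "z \<in> cell E n z" "z' \<in> cell E n z'"
    and "\<forall>v. 0 < z $ v \<and> z $ v < real n" "\<forall>v. 0 < z' $ v \<and> z' $ v < real n"
  shows "cell E n z = cell E n z' \<longleftrightarrow> pattern E UNIV (($) z) = pattern E UNIV (($) z')"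
proof -
  have "(\<forall>i\<in>{0..int n}. x < of_int i \<longleftrightarrow> y < of_int i) \<longleftrightarrow> \<lfloor>x\<rfloor> = \<lfloor>y\<rfloor>"
    if "0 < x" "x < real n" "0 < y" "y < real n" for x y :: real
  proof
    assume *: "\<forall>i\<in>{0..int n}. x < of_int i \<longleftrightarrow> y < of_int i"
    have "\<lfloor>x\<rfloor> < int n" "\<lfloor>y\<rfloor> < int n" "0 \<le> \<lfloor>x\<rfloor>" "0 \<le> \<lfloor>y\<rfloor>"
      using that by (auto simp: floor_less_iff)
    \<comment> \<open>As \<open>x < n\<close>, the integer \<open>\<lfloor>x\<rfloor> + 1\<close> is
      at most \<open>n\<close> and so is one of the test values; it shows that the floor of
      \<open>y\<close> is no larger than that of \<open>x\<close>. The converse is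
      symmetric.\<close>
    then show "\<lfloor>x\<rfloor> = \<lfloor>y\<rfloor>"
      using *[rule_format, of "\<lfloor>x\<rfloor> + 1"] *[rule_format, of "\<lfloor>y\<rfloor> + 1"]
      unfolding floor_less_iff[symmetric] by simp
  qed (simp flip: floor_less_iff)
  then have "(\<forall>v. \<forall>i\<in>{0..int n}. z' $ v < of_int i \<longleftrightarrow> z $ v < of_int i) \<longleftrightarrow>
      (\<forall>v. \<lfloor>z $ v\<rfloor> = \<lfloor>z' $ v\<rfloor>)"
    using assms(3,4) by metis
  then show ?thesis
    using assms(2) unfolding cell_eq_iff[OF assms(1,2)] pattern_eq_iff by (auto simp: cell_def)
qed

lemma bounded_regions_eq_cells:
  assumes "m - 2 = int n"
  shows "bounded_regions (graph_arrangement E m) =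
    cell E n ` {z. z \<in> cell E n z \<and> (\<forall>v. 0 < z $ v \<and> z $ v < real n)}"
proof -
  let ?U = "- \<Union>(graph_arrangement E m)"
  have U: "z \<in> ?U \<longleftrightarrow> z \<in> cell E n z" for z
    unfolding complement_graph_arrangement assms cell_def mem_Collect_eq by simp
  have "regions (graph_arrangement E m) = cell E n ` ?U"
    unfolding regions_def components_def
    by (intro image_cong refl component_graph_arrangement[OF assms])
  also have "?U = {z. z \<in> cell E n z}"
    by (rule set_eqI) (simp only: U mem_Collect_eq)
  finally have regions: "regions (graph_arrangement E m) = cell E n ` {z. z \<in> cell E n z}" .
  have "bounded_regions (graph_arrangement E m) =
      cell E n ` {z. z \<in> cell E n z \<and> bounded (cell E n z)}"
    unfolding bounded_regions_def regions by (rule set_eqI) (simp only: image_iff mem_Collect_eq Bex_def, metis)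
  also have "{z. z \<in> cell E n z \<and> bounded (cell E n z)} =
      {z. z \<in> cell E n z \<and> (\<forall>v. 0 < z $ v \<and> z $ v < real n)}"
    by (intro Collect_cong conj_cong refl bounded_cell_iff)
  finally show ?thesis .
qed

text \<open>Regions and patterns are images of the same set of generic points of the cube, under two
  maps that identify the same points.\<close>

lemma card_bounded_regions_eq_patterns:
  fixes E :: "'v::finite set set"
  assumes "m - 2 = int n"
  shows "finite (bounded_regions (graph_arrangement E m))"
    and "card (bounded_regions (graph_arrangement E m)) = card (patterns E UNIV n)"
proof -
  let ?G = "{z. z \<in> cell E n z \<and> (\<forall>v. 0 < z $ v \<and> z $ v < real n)}"
  have "z \<in> ?G \<longleftrightarrow> ($) z \<in> generic_points E UNIV n" for z
  proof -
    have "(\<forall>i\<in>{0..int n}. x \<noteq> of_int i) \<longleftrightarrow> x \<notin> \<int>" if "0 < x" "x < real n" for x :: real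
      using that by (auto elim!: Ints_cases)
    then show ?thesis by (auto simp: cell_def generic_points_def)
  qed
  then have G: "($) ` ?G = generic_points E UNIV n"
    by (auto simp: image_iff) (metis vec_lambda_inverse UNIV_I)
  have "patterns E UNIV n = (\<lambda>z. pattern E UNIV (($) z)) ` ?G"
    unfolding patterns_def G[symmetric] image_image ..
  moreover have "cell E n z = cell E n z' \<longleftrightarrow> pattern E UNIV (($) z) = pattern E UNIV (($) z')"
    if "z \<in> ?G" "z' \<in> ?G" for z z'
    using that cell_eq_iff_pattern_eq by blast
  ultimately show "finite (bounded_regions (graph_arrangement E m))"
    and "card (bounded_regions (graph_arrangement E m)) = card (patterns E UNIV n)"
    unfolding bounded_regions_eq_cells[OF assms]
    using card_image_same_kernel[of ?G "cell E n" "\<lambda>z. pattern E UNIV (($) z)"]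
      finite_patterns[of E UNIV n] by simp_all
qed

theorem theorem1p8:
  fixes E :: "'v::finite set set" and m :: int
  assumes "simple_graph E"
    and "m \<ge> 3"
  shows "finite (bounded_regions (graph_arrangement E m)) \<and>
    int (card (bounded_regions (graph_arrangement E m))) =
      (-1) ^ CARD('v) * poly (chromatic_poly E) (- (m - 2))"
proof -
  define n where "n = nat (m - 2)"
  have n: "m - 2 = int n" using assms(2) by (simp add: n_def)
  obtain p :: "'v set \<Rightarrow> int poly"
    where p: "\<And>W x. poly (p W) (int x) = int (card (colorings_on E W x))"
    using colorings_on_poly[of E] by metis
  have "colorings_on E UNIV x = proper_colorings E x" for x
    by (auto simp: colorings_on_def proper_colorings_def PiE_UNIV_domain)
  \<comment> \<open>A polynomial with the coloring counts as its values exists, namely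
    \<open>p UNIV\<close>, and is unique by \<open>int_poly_eqI_nat\<close>.\<close>
  then have "chromatic_poly E = p UNIV"
    unfolding chromatic_poly_def using p[of UNIV]
    by (intro the_equality) (auto intro!: int_poly_eqI_nat)
  then show ?thesis
    using card_bounded_regions_eq_patterns[OF n, of E] card_patterns_eq_poly[OF p, of UNIV n]
    by (simp add: n)
qed

end
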